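(* Let $k$ be a positive integer. For any nonnegative integers $d_1,\ldots,d_k$, $$\frac{1}{(aq;q)_\infty}=\sum_{n_1,\ldots,n_k\ge0}\frac{a^{\sum_{i=1}^kn_i}\,q^{\sum_{i=1}^kn_i^2+\sum_{i=1}^k(d_1+\cdots+d_i)n_i}}{(q;q)_{n_k-n_{k-1}+d_k}\cdots(q;q)_{n_2-n_1+d_2}}\cdot\frac{(q;q)_{n_k+d_k}\cdots(q;q)_{n_2+d_2}}{(q;q)_{n_k}\cdots(q;q)_{n_1}\,(aq;q)_{n_1+d_1}}.$$
   Context: $|q|<1$ (or $q$ is a formal variable), and $a$ is a parameter for which no denominator vanishes. For $n\in\mathbb{N}\cup\{\infty\}$, $(A;q)_n:=\prod_{j=0}^{n-1}(1-Aq^j)$; $1/(q;q)_n:=0$ for integers $n<0$. Empty products equal $1$ (so for $k=1$ the factors $(q;q)_{n_i-n_{i-1}+d_i}$ and $(q;q)_{n_i+d_i}$ with $i\ge2$ are absent). *)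

theory Defs
  imports "HOL-Analysis.Analysis"
begin

definition qpoch :: "complex \<Rightarrow> complex \<Rightarrow> nat \<Rightarrow> complex" where
  "qpoch A q n = (\<Prod>j<n. 1 - A * q ^ j)"

definition qpoch_inf :: "complex \<Rightarrow> complex \<Rightarrow> complex" where
  "qpoch_inf A q = prodinf (\<lambda>j. 1 - A * q ^ j)"

text \<open>
  The reciprocal \<open>1 / (q; q)\<^sub>n\<close> for integer \<open>n\<close>, which is \<open>0\<close> by convention for \<open>n < 0\<close>.
\<close>

definition recip_qpoch :: "complex \<Rightarrow> int \<Rightarrow> complex" where
  "recip_qpoch q n = (if n < 0 then 0 else 1 / qpoch q q (nat n))"

end

theory Submission
  imports Defs
begin

text \<open>
  The sum over \<open>n\<^sub>1\<close> is finite because of the factor \<open>1 / (q; q)\<close> at index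
  \<open>n\<^sub>2 - n\<^sub>1 + d\<^sub>2\<close>, and with \<open>N = n\<^sub>2 + d\<^sub>2\<close> it is evaluated by the finite Cauchy identity
  (the Durfee rectangle dissection)
  \<open>\<Sum>\<^sub>n a\<^sup>n q\<^bsup>n\<^sup>2 + D n\<^esup> / ((q)\<^bsub>N - n\<^esub> (q)\<^sub>n (aq)\<^bsub>n + D\<^esub>) = 1 / ((q)\<^sub>N (aq)\<^bsub>N + D\<^esub>)\<close>.
  The factor \<open>(q)\<^sub>N\<close> cancels, and what remains is the same sum in the variables
  \<open>n\<^sub>2, \<dots>, n\<^sub>k\<close> with \<open>D = d\<^sub>1\<close> replaced by \<open>d\<^sub>1 + d\<^sub>2\<close>. The last single sum is the limit
  \<open>N \<rightarrow> \<infinity>\<close> of the finite identity. Summing in this order is legitimate because all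
  q-Pochhammer symbols are bounded above and away from \<open>0\<close>, so that the summand is dominated
  by a constant times \<open>\<Prod>\<^sub>i |a|\<^bsup>n\<^sub>i\<^esup> |q|\<^bsup>n\<^sub>i\<^sup>2\<^esup>\<close>.
\<close>

section \<open>q-Pochhammer symbols: convergence and bounds\<close>

lemma qpoch_0 [simp]: "qpoch A q 0 = 1"
  by (simp add: qpoch_def)

lemma qpoch_Suc: "qpoch A q (Suc n) = qpoch A q n * (1 - A * q ^ n)"
  by (simp add: qpoch_def)

lemma qpoch_self_nonzero:
  assumes "norm q < 1"
  shows "qpoch q q n \<noteq> 0"
proof -
  have "1 - q * q ^ j \<noteq> 0" for j
  proof
    assume "1 - q * q ^ j = 0"
    then have "norm (q ^ Suc j) = 1"
      by (metis eq_iff_diff_eq_0 norm_one power_Suc)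
    moreover have "norm (q ^ Suc j) < 1"
      using assms by (simp add: norm_power power_less_one_iff del: power_Suc)
    ultimately show False by simp
  qed
  then show ?thesis by (simp add: qpoch_def)
qed

lemma convergent_prod_qpoch:
  assumes "norm q < 1" and "\<And>n. qpoch A q n \<noteq> 0"
  shows "convergent_prod (\<lambda>j. 1 - A * q ^ j)"
proof -
  have nz: "1 - A * q ^ j \<noteq> 0" for j
    using assms(2)[of "Suc j"] by (simp add: qpoch_Suc)
  have "summable (\<lambda>j. norm A * norm q ^ j)"
    using assms(1) by (intro summable_mult summable_geometric) simp
  then have "convergent_prod (\<lambda>j. 1 + (- (A * q ^ j)))"
  proof (intro summable_imp_convergent_prod_complex)
    show "- (A * q ^ j) \<noteq> - 1" for j
      using nz[of j] by simp
  qed (simp add: norm_mult norm_power)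
  then show ?thesis by simp
qed

lemma qpoch_tendsto_qpoch_inf:
  assumes "norm q < 1" and "\<And>n. qpoch A q n \<noteq> 0"
  shows "qpoch A q \<longlonglongrightarrow> qpoch_inf A q"
proof -
  \<comment> \<open>The library's partial products run over \<open>{..n}\<close>, hence the shift by
    one.\<close>
  have "(\<lambda>n. qpoch A q (Suc n)) \<longlonglongrightarrow> qpoch_inf A q"
    using convergent_prod_LIMSEQ[OF convergent_prod_qpoch[OF assms]]
    by (simp add: qpoch_def[abs_def] qpoch_inf_def lessThan_Suc_atMost)
  then show ?thesis by (rule LIMSEQ_imp_Suc)
qed

lemma qpoch_inf_nonzero:
  assumes "norm q < 1" and "\<And>n. qpoch A q n \<noteq> 0"
  shows "qpoch_inf A q \<noteq> 0"
  unfolding qpoch_inf_def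
proof (rule prodinf_nonzero[OF convergent_prod_qpoch[OF assms]])
  show "1 - A * q ^ j \<noteq> 0" for j
    using assms(2)[of "Suc j"] by (simp add: qpoch_Suc)
qed

text \<open>The limit is nonzero, so the reciprocals converge too. These bounds supply the constants
  of every dominating series below.\<close>

lemma Bseq_qpoch:
  assumes "norm q < 1" and "\<And>n. qpoch A q n \<noteq> 0"
  shows "Bseq (qpoch A q)" and "Bseq (\<lambda>n. 1 / qpoch A q n)"
proof -
  show "Bseq (qpoch A q)"
    using qpoch_tendsto_qpoch_inf[OF assms] by (intro convergent_imp_Bseq convergentI)
  have "(\<lambda>n. 1 / qpoch A q n) \<longlonglongrightarrow> 1 / qpoch_inf A q"
    by (intro tendsto_intros qpoch_tendsto_qpoch_inf qpoch_inf_nonzero assms)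
  then show "Bseq (\<lambda>n. 1 / qpoch A q n)"
    by (intro convergent_imp_Bseq convergentI)
qed

section \<open>Gaussian binomials and the finite Cauchy identity\<close>

lemma recip_qpoch_of_nat_diff:
  "recip_qpoch q (int N - int n) = (if n \<le> N then 1 / qpoch q q (N - n) else 0)"
  by (auto simp: recip_qpoch_def nat_diff_distrib)

text \<open>The quotients are Gaussian binomial coefficients, zero when the lower index exceeds the
  upper. For \<open>N = n + 1 + M\<close> the rule amounts to
  \<open>1 - q^(N+1) = q^(n+1) * (1 - q^(M+1)) + (1 - q^(n+1))\<close>.\<close>

lemma qbinomial_Pascal:
  assumes "norm q < 1"
  shows "qpoch q q (Suc N) * recip_qpoch q (int (Suc N) - int (Suc n)) / qpoch q q (Suc n) =
    q ^ Suc n * (qpoch q q N * recip_qpoch q (int N - int (Suc n)) / qpoch q q (Suc n)) +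
    qpoch q q N * recip_qpoch q (int N - int n) / qpoch q q n"
proof -
  note nz = qpoch_self_nonzero[OF assms]
  consider "n > N" | "n = N" | M where "N = Suc (n + M)"
    by (metis less_iff_Suc_add linorder_neqE_nat)
  then show ?thesis
  proof cases
    case 3
    have nz': "1 - q * q ^ j \<noteq> 0" for j
      using nz[of "Suc j"] by (simp add: qpoch_Suc)
    have "qpoch q q (Suc N) * recip_qpoch q (int (Suc N) - int (Suc n)) / qpoch q q (Suc n) =
        qpoch q q N * (1 - q * q ^ N) / (qpoch q q (Suc M) * qpoch q q (Suc n))"
      using 3 by (simp add: recip_qpoch_of_nat_diff qpoch_Suc[of q q "Suc (n + M)"] del: of_nat_Suc)
    moreover have "1 - q * q ^ N = q ^ Suc n * (1 - q * q ^ M) + (1 - q * q ^ n)"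
      using 3 by (simp add: power_add algebra_simps)
    moreover have "q ^ Suc n * (qpoch q q N * recip_qpoch q (int N - int (Suc n)) / qpoch q q (Suc n)) =
        qpoch q q N * (q ^ Suc n * (1 - q * q ^ M)) / (qpoch q q (Suc M) * qpoch q q (Suc n))"
      using 3 nz' by (simp add: recip_qpoch_of_nat_diff qpoch_Suc[of q q M] del: of_nat_Suc)
    moreover have "qpoch q q N * recip_qpoch q (int N - int n) / qpoch q q n =
        qpoch q q N * (1 - q * q ^ n) / (qpoch q q (Suc M) * qpoch q q (Suc n))"
      using 3 nz' by (simp add: recip_qpoch_of_nat_diff qpoch_Suc[of q q n] Suc_diff_le del: of_nat_Suc)
    ultimately show ?thesis
      by (simp only: ring_distribs add_divide_distrib)
  qed (use nz in \<open>simp_all add: recip_qpoch_of_nat_diff del: of_nat_Suc\<close>)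
qed

lemma finite_Cauchy_identity:
  assumes "norm q < 1" and nz: "\<And>n. qpoch (a * q) q n \<noteq> 0"
  shows "(\<Sum>n\<le>N. qpoch q q N * recip_qpoch q (int N - int n) / qpoch q q n *
      (a ^ n * q ^ (n\<^sup>2 + D * n) / qpoch (a * q) q (n + D))) = 1 / qpoch (a * q) q (N + D)"
proof (induction N arbitrary: D)
  case 0
  then show ?case by (simp add: recip_qpoch_def)
next
  case (Suc N)
  define b where "b N n = qpoch q q N * recip_qpoch q (int N - int n) / qpoch q q n" for N n
  define t where "t D n = a ^ n * q ^ (n\<^sup>2 + D * n) / qpoch (a * q) q (n + D)" for D n
  have b0: "b N 0 = 1" for N
    using qpoch_self_nonzero[OF assms(1)] by (simp add: b_def recip_qpoch_def)
  have bN: "b N (Suc N) = 0"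
    by (simp add: b_def recip_qpoch_def)
  have Pascal: "b (Suc N) (Suc n) = q ^ Suc n * b N (Suc n) + b N n" for n
    unfolding b_def by (rule qbinomial_Pascal[OF assms(1)])
  have step: "q ^ n * t D n + t D (Suc n) = t (Suc D) n" for n
  proof -
    \<comment> \<open>\<open>r\<close> is the last factor of the denominator of
      \<open>t (Suc D) n\<close>. Over that denominator the two terms carry the weights
      \<open>r\<close> and \<open>1 - r\<close>, which add up to 1.\<close>
    define r where "r = 1 - a * q * q ^ (n + D)"
    have r: "r \<noteq> 0" "qpoch (a * q) q (Suc (n + D)) = qpoch (a * q) q (n + D) * r"
      using nz[of "Suc (n + D)"] by (simp_all add: r_def qpoch_Suc)
    have "q ^ n * t D n = a ^ n * q ^ (n\<^sup>2 + Suc D * n) * r / qpoch (a * q) q (Suc (n + D))"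
      using r by (simp add: t_def power_add)
    moreover have "t D (Suc n) =
        a ^ n * q ^ (n\<^sup>2 + Suc D * n) * (1 - r) / qpoch (a * q) q (Suc (n + D))"
      by (simp add: t_def r_def power2_eq_square power_add algebra_simps)
    ultimately have "q ^ n * t D n + t D (Suc n) =
        a ^ n * q ^ (n\<^sup>2 + Suc D * n) * (r + (1 - r)) / qpoch (a * q) q (Suc (n + D))"
      by (simp only: distrib_left add_divide_distrib)
    then show ?thesis
      by (simp add: t_def)
  qed
  \<comment> \<open>Pascal's rule and the recombination of terms in \<open>step\<close> shift \<open>N + 1, D\<close> to \<open>N, D + 1\<close>.\<close>
  have "(\<Sum>n\<le>Suc N. b (Suc N) n * t D n) =
      t D 0 + (\<Sum>n\<le>N. q ^ Suc n * b N (Suc n) * t D (Suc n)) + (\<Sum>n\<le>N. b N n * t D (Suc n))"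
    unfolding sum.atMost_Suc_shift by (simp add: Pascal b0 ring_distribs sum.distrib del: power_Suc)
  \<comment> \<open>\<open>t D 0\<close> is the missing term at index 0; the term at the top index
    \<open>Suc N\<close> vanishes by \<open>bN\<close>.\<close>
  also have "t D 0 + (\<Sum>n\<le>N. q ^ Suc n * b N (Suc n) * t D (Suc n)) =
      (\<Sum>n\<le>Suc N. q ^ n * b N n * t D n)"
    by (simp add: sum.atMost_Suc_shift b0 del: power_Suc sum.atMost_Suc)
  also have "\<dots> = (\<Sum>n\<le>N. q ^ n * b N n * t D n)"
    by (simp add: bN)
  also have "\<dots> + (\<Sum>n\<le>N. b N n * t D (Suc n)) = (\<Sum>n\<le>N. b N n * t (Suc D) n)"
    by (simp add: algebra_simps flip: sum.distrib step)
  also have "\<dots> = 1 / qpoch (a * q) q (Suc N + D)"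
    using Suc.IH[of "Suc D"] by (simp add: b_def t_def)
  finally show ?case
    by (simp add: b_def t_def)
qed

section \<open>Passage to the limit in the finite identity\<close>

text \<open>The ratio of consecutive terms is \<open>A * Q^(2n+1)\<close>, which tends to 0 however
  large \<open>A\<close> is.\<close>

lemma summable_power_square:
  fixes A Q :: real
  assumes "0 \<le> A" "0 \<le> Q" "Q < 1"
  shows "summable (\<lambda>n. A ^ n * Q ^ n\<^sup>2)"
proof -
  have "(\<lambda>n. A * Q ^ n) \<longlonglongrightarrow> A * 0"
    using assms by (intro tendsto_intros LIMSEQ_realpow_zero)
  then have "eventually (\<lambda>n. A * Q ^ n < 1/2) sequentially"
    by (rule order_tendstoD) simp
  then obtain N where N: "\<And>n. n \<ge> N \<Longrightarrow> A * Q ^ n < 1/2"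
    by (auto simp: eventually_sequentially)
  show ?thesis
  proof (rule summable_ratio_test[where c = "1/2" and N = N])
    fix n assume "n \<ge> N"
    have "A * Q ^ (2 * n + 1) \<le> A * Q ^ n"
      using assms by (intro mult_left_mono power_decreasing) auto
    also have "\<dots> \<le> 1/2"
      using N[OF \<open>n \<ge> N\<close>] by simp
    finally have "A * Q ^ (2 * n + 1) * (A ^ n * Q ^ n\<^sup>2) \<le> 1/2 * (A ^ n * Q ^ n\<^sup>2)"
      using assms by (intro mult_right_mono) auto
    moreover have "(Suc n)\<^sup>2 = (2 * n + 1) + n\<^sup>2"
      by (simp add: power2_eq_square)
    then have "A ^ Suc n * Q ^ (Suc n)\<^sup>2 = A * Q ^ (2 * n + 1) * (A ^ n * Q ^ n\<^sup>2)"
      by (simp only: power_add power_Suc mult_ac)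
    ultimately have "A ^ Suc n * Q ^ (Suc n)\<^sup>2 \<le> 1/2 * (A ^ n * Q ^ n\<^sup>2)"
      by (simp only:)
    then show "norm (A ^ Suc n * Q ^ (Suc n)\<^sup>2) \<le> 1/2 * norm (A ^ n * Q ^ n\<^sup>2)"
      using assms by (simp add: abs_mult del: power_Suc)
  qed simp
qed

lemma Bseq_obtain_bound:
  fixes f :: "nat \<Rightarrow> 'a :: real_normed_vector"
  assumes "Bseq f"
  obtains C where "C \<ge> 1" "\<And>n. norm (f n) \<le> C"
proof -
  from assms obtain K where "\<And>n. norm (f n) \<le> K"
    by (auto simp: Bseq_def)
  then have "norm (f n) \<le> max 1 K" for n
    by (meson le_max_iff_disj)
  then show ?thesis
    by (intro that[of "max 1 K"]) auto
qed

lemma norm_recip_qpoch_le: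
  assumes "\<And>n. norm (1 / qpoch q q n) \<le> C" and "C \<ge> 0"
  shows "norm (recip_qpoch q n) \<le> C"
  using assms by (simp add: recip_qpoch_def)

text \<open>Tannery's theorem applies because the only factor depending on \<open>N\<close>, namely
  \<open>c n N\<close>, is uniformly bounded and tends to 1 for fixed \<open>n\<close>.\<close>

lemma Cauchy_identity:
  assumes "norm q < 1" and nz: "\<And>n. qpoch (a * q) q n \<noteq> 0"
  shows "((\<lambda>n. a ^ n * q ^ (n\<^sup>2 + D * n) / qpoch q q n / qpoch (a * q) q (n + D))
    has_sum (1 / qpoch_inf (a * q) q)) UNIV"
proof -
  note qnz = qpoch_self_nonzero[OF assms(1)]
  obtain C1 where C1: "C1 \<ge> 1" "\<And>n. norm (qpoch q q n) \<le> C1"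
    using Bseq_obtain_bound[OF Bseq_qpoch(1)[OF assms(1) qnz]] by blast
  obtain C2 where C2: "C2 \<ge> 1" "\<And>n. norm (1 / qpoch q q n) \<le> C2"
    using Bseq_obtain_bound[OF Bseq_qpoch(2)[OF assms(1) qnz]] by blast
  obtain C3 where C3: "C3 \<ge> 1" "\<And>n. norm (1 / qpoch (a * q) q n) \<le> C3"
    using Bseq_obtain_bound[OF Bseq_qpoch(2)[OF assms]] by blast
  define t where "t n = a ^ n * q ^ (n\<^sup>2 + D * n) / qpoch q q n / qpoch (a * q) q (n + D)" for n
  define c where "c n N = qpoch q q N * recip_qpoch q (int N - int n)" for n N
  define M where "M n = C1 * C2 * (C2 * C3) * (norm a ^ n * norm q ^ n\<^sup>2)" for n
  have "summable M"
    unfolding M_def using assms(1) by (intro summable_mult summable_power_square) auto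
  have t_le: "norm (t n) \<le> C2 * C3 * (norm a ^ n * norm q ^ n\<^sup>2)" for n
  proof -
    have "norm (t n) = norm a ^ n * norm q ^ (n\<^sup>2 + D * n) *
        (norm (1 / qpoch q q n) * norm (1 / qpoch (a * q) q (n + D)))"
      by (simp add: t_def norm_mult norm_divide norm_power)
    also have "\<dots> \<le> norm a ^ n * norm q ^ n\<^sup>2 * (C2 * C3)"
      using assms(1) C2 C3 by (intro mult_mono power_decreasing[where a = "norm q"]) auto
    finally show ?thesis by (simp add: mult_ac)
  qed
  have c_le: "norm (c n N) \<le> C1 * C2" for n N
    unfolding c_def norm_mult using C1 C2
    by (intro mult_mono norm_recip_qpoch_le) auto
  have lim: "(\<lambda>N. c n N * t n) \<longlonglongrightarrow> t n" for n
  proof -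
    \<comment> \<open>Shifting \<open>N\<close> by \<open>n\<close> avoids the range where
      \<open>recip_qpoch\<close> is 0 by convention.\<close>
    have "(\<lambda>N. qpoch q q (N + n) / qpoch q q N * t n) \<longlonglongrightarrow> qpoch_inf q q / qpoch_inf q q * t n"
      by (intro tendsto_intros LIMSEQ_ignore_initial_segment qpoch_tendsto_qpoch_inf
          qpoch_inf_nonzero assms(1) qnz)
    then have "(\<lambda>N. c n (N + n) * t n) \<longlonglongrightarrow> t n"
      using qpoch_inf_nonzero[OF assms(1) qnz] by (simp add: c_def recip_qpoch_def)
    then show ?thesis
      by (rule LIMSEQ_offset)
  qed
  have bound: "norm (c n N * t n) \<le> M n" for n N
    unfolding M_def norm_mult mult.assoc[of "C1 * C2"]
    using c_le t_le C1 C2 by (intro mult_mono) auto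
  have Tannery: "summable (\<lambda>n. norm (t n)) \<and> (\<lambda>N. \<Sum>n. c n N * t n) \<longlonglongrightarrow> suminf t"
  proof -
    have "eventually (\<lambda>(n, N). norm (c n N * t n) \<le> M n) (sequentially \<times>\<^sub>F sequentially)"
      by (rule always_eventually) (use bound in auto)
    from tannerys_theorem[OF lim this \<open>summable M\<close>] show ?thesis
      by simp
  qed
  have "(\<Sum>n. c n N * t n) = 1 / qpoch (a * q) q (N + D)" for N
  proof -
    have "(\<Sum>n. c n N * t n) = (\<Sum>n\<le>N. c n N * t n)"
      by (rule suminf_finite) (auto simp: c_def recip_qpoch_def)
    also have "\<dots> = 1 / qpoch (a * q) q (N + D)"
      unfolding finite_Cauchy_identity[OF assms, symmetric] by (simp add: c_def t_def mult_ac)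
    finally show ?thesis .
  qed
  moreover have "(\<lambda>N. 1 / qpoch (a * q) q (N + D)) \<longlonglongrightarrow> 1 / qpoch_inf (a * q) q"
    by (intro tendsto_intros LIMSEQ_ignore_initial_segment qpoch_tendsto_qpoch_inf
        qpoch_inf_nonzero assms)
  ultimately have "suminf t = 1 / qpoch_inf (a * q) q"
    using Tannery LIMSEQ_unique by auto
  then have "t sums (1 / qpoch_inf (a * q) q)"
    using Tannery by (auto simp: sums_iff dest: summable_norm_cancel)
  then have "(t has_sum (1 / qpoch_inf (a * q) q)) UNIV"
    using Tannery by (intro norm_summable_imp_has_sum) auto
  then show ?thesis
    by (simp add: t_def[abs_def])
qed

section \<open>The multiple sum, one variable at a time\<close>

text \<open>The summand left over once the variables with index below \<open>m\<close> have been summed out.\<close>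

definition tail_term ::
    "complex \<Rightarrow> complex \<Rightarrow> (nat \<Rightarrow> nat) \<Rightarrow> nat \<Rightarrow> nat \<Rightarrow> (nat \<Rightarrow> nat) \<Rightarrow> complex" where
  "tail_term a q d k m n =
    (\<Prod>i=m..k. a ^ n i * q ^ ((n i)\<^sup>2 + (\<Sum>j=1..i. d j) * n i) / qpoch q q (n i)) *
    (\<Prod>i=Suc m..k. recip_qpoch q (int (n i) - int (n (i - 1)) + int (d i)) * qpoch q q (n i + d i)) /
    qpoch (a * q) q (n m + (\<Sum>j=1..m. d j))"

text \<open>The factors indexed by \<open>i\<close> in the first product are dominated by
  \<open>u (n i)\<close>, all others by constants, and a product of summable one-variable functions
  is summable over \<open>PiE\<close>.\<close>

lemma tail_term_summable:
  assumes "norm q < 1" and "\<And>n. qpoch (a * q) q n \<noteq> 0"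
  shows "tail_term a q d k m summable_on ({m..k} \<rightarrow>\<^sub>E UNIV)"
proof -
  note qnz = qpoch_self_nonzero[OF assms(1)]
  obtain C1 where C1: "C1 \<ge> 1" "\<And>n. norm (qpoch q q n) \<le> C1"
    using Bseq_obtain_bound[OF Bseq_qpoch(1)[OF assms(1) qnz]] by blast
  obtain C2 where C2: "C2 \<ge> 1" "\<And>n. norm (1 / qpoch q q n) \<le> C2"
    using Bseq_obtain_bound[OF Bseq_qpoch(2)[OF assms(1) qnz]] by blast
  obtain C3 where C3: "C3 \<ge> 1" "\<And>n. norm (1 / qpoch (a * q) q n) \<le> C3"
    using Bseq_obtain_bound[OF Bseq_qpoch(2)[OF assms]] by blast
  define u where "u x = norm a ^ x * norm q ^ x\<^sup>2 * C2" for x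
  have "u summable_on UNIV"
    unfolding u_def using assms(1) C2
    by (intro norm_summable_imp_summable_on)
      (simp add: abs_mult summable_mult2 summable_power_square)
  then have "Infinite_Sum.abs_summable_on u UNIV"
    using summable_on_iff_abs_summable_on_real by blast
  \<comment> \<open>The product rule is stated for the measure-theoretic notion of absolute
    summability, hence the translation.\<close>
  then have "Infinite_Sum.abs_summable_on (\<lambda>n. \<Prod>i\<in>{m..k}. u (n i)) ({m..k} \<rightarrow>\<^sub>E UNIV)"
    unfolding abs_summable_equivalent by (intro abs_summable_on_prod_PiE) auto
  then have "(\<lambda>n. \<Prod>i\<in>{m..k}. u (n i)) summable_on ({m..k} \<rightarrow>\<^sub>E UNIV)"
    by (rule abs_summable_summable)
  then have "(\<lambda>n. (\<Prod>i\<in>{m..k}. u (n i)) * ((\<Prod>i=Suc m..k. C2 * C1) * C3)) summable_on ({m..k} \<rightarrow>\<^sub>E UNIV)"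
    by (rule summable_on_cmult_left)
  then have "(\<lambda>n. norm (tail_term a q d k m n)) summable_on ({m..k} \<rightarrow>\<^sub>E UNIV)"
  proof (rule Infinite_Sum.abs_summable_on_comparison_test')
    fix n
    have "norm (tail_term a q d k m n) =
      (\<Prod>i=m..k. norm a ^ n i * norm q ^ ((n i)\<^sup>2 + (\<Sum>j=1..i. d j) * n i) * norm (1 / qpoch q q (n i))) *
      ((\<Prod>i=Suc m..k. norm (recip_qpoch q (int (n i) - int (n (i - 1)) + int (d i))) * norm (qpoch q q (n i + d i))) *
        norm (1 / qpoch (a * q) q (n m + (\<Sum>j=1..m. d j))))"
      by (simp add: tail_term_def norm_mult norm_divide norm_power flip: prod_norm)
    also have "\<dots> \<le> (\<Prod>i\<in>{m..k}. u (n i)) * ((\<Prod>i=Suc m..k. C2 * C1) * C3)"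
    proof (intro mult_mono prod_mono conjI)
      fix i
      show "norm a ^ n i * norm q ^ ((n i)\<^sup>2 + (\<Sum>j=1..i. d j) * n i) * norm (1 / qpoch q q (n i)) \<le> u (n i)"
        unfolding u_def using assms(1) C2 by (intro mult_mono power_decreasing[where a = "norm q"]) auto
      show "norm (recip_qpoch q (int (n i) - int (n (i - 1)) + int (d i))) \<le> C2"
        using C2 by (intro norm_recip_qpoch_le) auto
    qed (use C1 C2 C3 in \<open>auto simp: u_def intro!: prod_nonneg mult_nonneg_nonneg\<close>)
    finally show "norm (tail_term a q d k m n) \<le> \<dots>" .
  qed
  then show ?thesis
    by (rule abs_summable_summable)
qed

lemma sum_out_lowest_index:
  assumes "norm q < 1" and "\<And>n. qpoch (a * q) q n \<noteq> 0" and "m < k"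
  shows "((\<lambda>x. tail_term a q d k m (g(m := x))) has_sum tail_term a q d k (Suc m) g) UNIV"
proof -
  note qnz = qpoch_self_nonzero[OF assms(1)]
  define D where "D i = (\<Sum>j=1..i. d j)" for i
  define N where "N = g (Suc m) + d (Suc m)"
  define P where "P = (\<Prod>i=Suc m..k. a ^ g i * q ^ ((g i)\<^sup>2 + D i * g i) / qpoch q q (g i))"
  \<comment> \<open>The factor at \<open>Suc m\<close> is left out because its difference involves
    the summation variable; it goes into \<open>s\<close>.\<close>
  define R where "R = (\<Prod>i=Suc (Suc m)..k.
    recip_qpoch q (int (g i) - int (g (i - 1)) + int (d i)) * qpoch q q (g i + d i))"
  define s where "s x = qpoch q q N * recip_qpoch q (int N - int x) / qpoch q q x *
      (a ^ x * q ^ (x\<^sup>2 + D m * x) / qpoch (a * q) q (x + D m))" for x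
  have "(s has_sum (1 / qpoch (a * q) q (N + D m))) UNIV"
    unfolding finite_Cauchy_identity[OF assms(1,2), symmetric]
    by (rule has_sum_finite_neutralI[where B = "{..N}"]) (auto simp: s_def recip_qpoch_def)
  then have "((\<lambda>x. P * R * s x) has_sum (P * R * (1 / qpoch (a * q) q (N + D m)))) UNIV"
    by (rule has_sum_cmult_right)
  \<comment> \<open>The indices match since \<open>N + D m = g (Suc m) + D (Suc m)\<close>.\<close>
  moreover have "P * R * (1 / qpoch (a * q) q (N + D m)) = tail_term a q d k (Suc m) g"
    by (simp add: tail_term_def P_def R_def N_def D_def algebra_simps)
  moreover have "P * R * s x = tail_term a q d k m (g(m := x))" for x
  proof -
    let ?g = "g(m := x)"
    have 1: "(\<Prod>i=m..k. a ^ ?g i * q ^ ((?g i)\<^sup>2 + D i * ?g i) / qpoch q q (?g i)) =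
        a ^ x * q ^ (x\<^sup>2 + D m * x) / qpoch q q x * P"
      unfolding P_def using \<open>m < k\<close> by (subst prod.atLeast_Suc_atMost) (auto intro!: prod.cong)
    have 2: "(\<Prod>i=Suc m..k. recip_qpoch q (int (?g i) - int (?g (i - 1)) + int (d i)) * qpoch q q (?g i + d i)) =
        recip_qpoch q (int N - int x) * qpoch q q N * R"
      unfolding R_def using \<open>m < k\<close>
      by (subst prod.atLeast_Suc_atMost) (auto simp: N_def algebra_simps intro!: prod.cong)
    show ?thesis
      unfolding tail_term_def D_def[symmetric] 1 2 by (simp add: s_def mult_ac)
  qed
  ultimately show ?thesis by simp
qed

text \<open>Downward induction from \<open>m = k\<close>, where only the single Cauchy sum remains;
  each step splits off the coordinate \<open>m\<close>.\<close>

lemma tail_term_has_sum: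
  assumes "norm q < 1" and "\<And>n. qpoch (a * q) q n \<noteq> 0" and "m \<le> k"
  shows "(tail_term a q d k m has_sum (1 / qpoch_inf (a * q) q)) ({m..k} \<rightarrow>\<^sub>E UNIV)"
  using assms(3)
proof (induction rule: inc_induct)
  case base
  \<comment> \<open>Members of \<open>PiE\<close> are \<open>undefined\<close> off the index set, so
    \<open>?h\<close> identifies the naturals with the functions on \<open>{k}\<close>.\<close>
  let ?h = "\<lambda>x. (\<lambda>_. undefined)(k := x) :: nat \<Rightarrow> nat"
  have "tail_term a q d k k \<circ> ?h = (\<lambda>x. a ^ x * q ^ (x\<^sup>2 + (\<Sum>j=1..k. d j) * x) / qpoch q q x /
      qpoch (a * q) q (x + (\<Sum>j=1..k. d j)))"
    by (simp add: tail_term_def fun_eq_iff)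
  moreover have "{k..k} \<rightarrow>\<^sub>E UNIV = range ?h"
    using PiE_insert_eq[of k "{}" "\<lambda>_. UNIV"] by (auto simp: image_iff)
  moreover have "inj ?h"
    by (metis (mono_tags) fun_upd_same injI)
  ultimately show ?case
    using Cauchy_identity[OF assms(1,2), of "\<Sum>j=1..k. d j"] by (simp add: has_sum_reindex)
next
  case (step m)
  let ?h = "\<lambda>(x, g). g(m := x) :: nat \<Rightarrow> nat"
  let ?S = "{Suc m..k} \<rightarrow>\<^sub>E (UNIV :: nat set)"
  have "{m..k} = insert m {Suc m..k}"
    using step.hyps by auto
  then have "({m..k} \<rightarrow>\<^sub>E UNIV) = ?h ` (UNIV \<times> ?S)"
    by (simp only: PiE_insert_eq)
  moreover have "inj_on ?h (UNIV \<times> ?S)"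
    by (rule inj_combinator) simp
  ultimately have iff: "(tail_term a q d k m has_sum S) ({m..k} \<rightarrow>\<^sub>E UNIV) \<longleftrightarrow>
      ((\<lambda>(g, x). tail_term a q d k m (g(m := x))) has_sum S) (?S \<times> UNIV)" for S
    by (simp add: has_sum_reindex has_sum_swap[where A = UNIV and B = ?S] o_def case_prod_unfold)
  \<comment> \<open>Summability provides some value \<open>S\<close>. Summing over \<open>x\<close>
    first shows that \<open>S\<close> is also the sum for \<open>Suc m\<close>, and uniqueness of
    sums then identifies it.\<close>
  obtain S where S: "(tail_term a q d k m has_sum S) ({m..k} \<rightarrow>\<^sub>E UNIV)"
    using tail_term_summable[OF assms(1,2)] unfolding summable_on_def by blast
  then have "(tail_term a q d k (Suc m) has_sum S) ?S"
    unfolding iff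
    by (rule has_sum_SigmaD) (use sum_out_lowest_index[OF assms(1,2)] step.hyps in auto)
  then show ?case
    using step.IH S has_sum_unique by blast
qed

theorem theorem1p3:
  fixes k :: nat and d :: "nat \<Rightarrow> nat" and a q :: complex
  assumes "k \<ge> 1"
    and "norm q < 1"
    and "\<And>n. qpoch (a * q) q n \<noteq> 0"
  shows "((\<lambda>n :: nat \<Rightarrow> nat.
            a ^ (\<Sum>i=1..k. n i) *
            q ^ ((\<Sum>i=1..k. n i ^ 2) + (\<Sum>i=1..k. (\<Sum>j=1..i. d j) * n i)) *
            (\<Prod>i=2..k. recip_qpoch q (int (n i) - int (n (i - 1)) + int (d i))) *
            ((\<Prod>i=2..k. qpoch q q (n i + d i)) /
             ((\<Prod>i=1..k. qpoch q q (n i)) * qpoch (a * q) q (n 1 + d 1))))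
          has_sum (1 / qpoch_inf (a * q) q)) ({1..k} \<rightarrow>\<^sub>E UNIV)"
proof -
  have "tail_term a q d k 1 = (\<lambda>n. a ^ (\<Sum>i=1..k. n i) *
            q ^ ((\<Sum>i=1..k. n i ^ 2) + (\<Sum>i=1..k. (\<Sum>j=1..i. d j) * n i)) *
            (\<Prod>i=2..k. recip_qpoch q (int (n i) - int (n (i - 1)) + int (d i))) *
            ((\<Prod>i=2..k. qpoch q q (n i + d i)) /
             ((\<Prod>i=1..k. qpoch q q (n i)) * qpoch (a * q) q (n 1 + d 1))))"
    \<comment> \<open>\<open>numeral_2_eq_2\<close> matches the lower bound 2 with
      \<open>Suc m\<close> at \<open>m = 1\<close>.\<close>
    by (simp add: tail_term_def fun_eq_iff prod.distrib prod_dividef power_add power_sum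
        numeral_2_eq_2)
  then show ?thesis
    using tail_term_has_sum[OF assms(2,3,1), of d] by simp
qed

end
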